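(* Let $k=\mathbb{F}_3$, equip $k^7$ with the bilinear form $\langle x,y\rangle=x_1y_7+x_2y_6+\dots+x_7y_1$, let $SO_7$ be the corresponding special orthogonal group and $B\subset SO_7$ the Borel subgroup of upper triangular matrices in $SO_7$. Let $A$ be a $7\times7$ matrix over $k$ self-adjoint for this form, and let \[ X_A(k)=\{gB(k)\in SO_7(k)/B(k):\ M=g^{-1}Ag \text{ satisfies } M_{ij}=0 \text{ for all } (i,j)\in P\}, \] where $P=\{(3,1),(4,1),(5,1),(5,2),(6,1),(6,2),(6,3),(7,1),(7,2),(7,3),(7,4),(7,5)\}$. If there is no nonzero $v\in k^7$ such that $\langle v,v\rangle=\langle v,Av\rangle=\langle Av,Av\rangle=\langle Av,A^2v\rangle=0$ and $\langle A^2v,A^2v\rangle$ is a square in $k$, then $X_A(k)=\emptyset$.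
   Context: $M_{ij}$ denotes the entry in row $i$ and column $j$. The defining condition of $X_A(k)$ is invariant under right multiplication of $g$ by $B(k)$, so $X_A(k)$ is well defined. *)

theory Defs
  imports "HOL-Analysis.Analysis" "HOL-Library.Numeral_Type"
begin

text \<open>The field k = F_3 is the type 3 (integers mod 3). Vectors in k^7 are
  indexed by the type 7; the paper's index i in {1..7} corresponds to idx i.\<close>

type_synonym F3 = 3
type_synonym vec7 = "F3 ^ 7"
type_synonym mat7 = "F3 ^ 7 ^ 7"

definition idx :: "nat \<Rightarrow> 7" where
  "idx i = of_nat (i - 1)"

text \<open>Bilinear form x_1 y_7 + x_2 y_6 + ... + x_7 y_1.\<close>
definition form :: "vec7 \<Rightarrow> vec7 \<Rightarrow> F3" where
  "form x y = (\<Sum>i\<in>{1..7}. x $ idx i * y $ idx (8 - i))"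

definition SO7 :: "mat7 set" where
  "SO7 = {g. det g = 1 \<and> (\<forall>x y. form (g *v x) (g *v y) = form x y)}"

definition Borel7 :: "mat7 set" where
  "Borel7 = {b \<in> SO7. \<forall>i\<in>{1..7}. \<forall>j\<in>{1..7}. j < i \<longrightarrow> b $ idx i $ idx j = 0}"

definition self_adjoint7 :: "mat7 \<Rightarrow> bool" where
  "self_adjoint7 A \<longleftrightarrow> (\<forall>x y. form (A *v x) y = form x (A *v y))"

definition Ppos :: "(nat \<times> nat) set" where
  "Ppos = {(3,1),(4,1),(5,1),(5,2),(6,1),(6,2),(6,3),(7,1),(7,2),(7,3),(7,4),(7,5)}"

text \<open>X_A(k), as a set of left cosets g B(k) in SO_7(k).\<close>
definition XA :: "mat7 \<Rightarrow> mat7 set set" where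
  "XA A = {(\<lambda>b. g ** b) ` Borel7 | g. g \<in> SO7 \<and>
      (let M = matrix_inv g ** A ** g in \<forall>(i,j)\<in>Ppos. M $ idx i $ idx j = 0)}"

definition is_square :: "F3 \<Rightarrow> bool" where
  "is_square a \<longleftrightarrow> (\<exists>c. a = c * c)"

end

theory Submission
  imports Defs
begin

text \<open>Suppose \<open>g B(k) \<in> X_A(k)\<close> and put \<open>M = g\<^sup>-\<^sup>1 A g\<close>. Writing \<open>V\<^sub>n\<close> for the span of
  \<open>e\<^sub>1, \<dots>, e\<^sub>n\<close>, the vanishing pattern \<open>P\<close> says exactly enough to give \<open>M V\<^sub>1 \<subseteq> V\<^sub>2\<close> and
  \<open>M V\<^sub>2 \<subseteq> V\<^sub>4\<close>. Since \<open>V\<^sub>m \<bottom> V\<^sub>n\<close> whenever \<open>m + n \<le> 7\<close>, and \<open>\<langle>w, w\<rangle> = w\<^sub>4\<^sup>2\<close> for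
  \<open>w \<in> V\<^sub>4\<close>, the vector \<open>e\<^sub>1\<close> satisfies the five conditions for \<open>M\<close>; as \<open>g\<close> is an isometry
  with \<open>g M = A g\<close>, the nonzero vector \<open>g e\<^sub>1\<close> satisfies them for \<open>A\<close>.\<close>

lemma idx_image_eq_UNIV: "idx ` {1..7} = UNIV"
proof (intro set_eqI iffI)
  fix x :: 7
  obtain z where "x = of_int z" "0 \<le> z" "z < 7" by (cases x) auto
  then have "x = idx (nat z + 1)" by (simp add: idx_def)
  moreover have "nat z + 1 \<in> {1..7}" using \<open>z < 7\<close> by simp
  ultimately show "x \<in> idx ` {1..7}" by blast
qed simp

lemma bij_betw_idx: "bij_betw idx {1..7} UNIV"
proof -
  have "card (idx ` {1..7}) = card {1..7::nat}" unfolding idx_image_eq_UNIV by simp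
  then show ?thesis
    unfolding bij_betw_def using idx_image_eq_UNIV by (blast intro: eq_card_imp_inj_on)
qed

lemma idx_eq_iff: "i \<in> {1..7} \<Longrightarrow> j \<in> {1..7} \<Longrightarrow> idx i = idx j \<longleftrightarrow> i = j"
  using bij_betw_idx by (auto simp: bij_betw_def dest: inj_onD)

lemma idx_reflect: "i \<in> {1..7} \<Longrightarrow> idx (8 - i) = 6 - idx i"
  by (auto simp: idx_def of_nat_diff)

lemma sum_UNIV_idx: "(\<Sum>k\<in>UNIV. f k) = (\<Sum>i\<in>{1..7}. f (idx i))"
  by (rule sum.reindex_bij_betw[OF bij_betw_idx, symmetric])

lemma sum_UNIV_reflect:
  fixes f :: "'a::{finite, ab_group_add} \<Rightarrow> 'b::comm_monoid_add"
  shows "(\<Sum>k\<in>UNIV. f (c - k)) = (\<Sum>k\<in>UNIV. f k)"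
  by (rule sum.reindex_bij_witness[of _ "\<lambda>k. c - k" "\<lambda>k. c - k"]) auto

lemma form_eq_sum_UNIV: "form x y = (\<Sum>k\<in>UNIV. x $ k * y $ (6 - k))"
  by (simp add: form_def sum_UNIV_idx idx_reflect)

lemma form_diff_left: "form (x - y) z = form x z - form y z"
  by (simp add: form_def algebra_simps sum_subtractf)

lemma diff_eq_swap: "a - b = c \<longleftrightarrow> b = a - (c::'a::ab_group_add)"
  by (auto simp: algebra_simps)

lemma form_axis_right: "form x (axis c 1) = x $ (6 - c)"
proof -
  have "form x (axis c 1) = (\<Sum>k\<in>UNIV. if k = 6 - c then x $ k else 0)"
    unfolding form_eq_sum_UNIV axis_def
    by (intro sum.cong refl) (simp only: vec_lambda_beta diff_eq_swap, simp)
  then show ?thesis by simp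
qed

lemma form_nondegenerate:
  assumes "\<And>y. form x y = 0"
  shows "x = 0"
proof -
  have "x $ k = form x (axis (6 - k) 1)" for k by (simp add: form_axis_right)
  then show ?thesis using assms by (simp add: vec_eq_iff)
qed

text \<open>This is \<open>J g\<^sup>T J\<close>, where the antidiagonal matrix \<open>J\<close> is the Gram matrix of the form.\<close>
definition form_adjoint :: "mat7 \<Rightarrow> mat7" where
  "form_adjoint g = (\<chi> i j. g $ (6 - j) $ (6 - i))"

lemma form_adjoint: "form (form_adjoint g *v x) y = form x (g *v y)"
proof -
  have "form (form_adjoint g *v x) y
      = (\<Sum>k\<in>UNIV. \<Sum>j\<in>UNIV. x $ j * (g $ (6 - j) $ (6 - k) * y $ (6 - k)))"
    unfolding form_eq_sum_UNIV form_adjoint_def matrix_vector_mult_def sum_distrib_right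
    by (intro sum.cong refl) (simp add: sum_distrib_left mult_ac)
  also have "\<dots> = (\<Sum>j\<in>UNIV. x $ j * (\<Sum>k\<in>UNIV. g $ (6 - j) $ (6 - k) * y $ (6 - k)))"
    unfolding sum_distrib_left by (rule sum.swap)
  also have "\<dots> = (\<Sum>j\<in>UNIV. x $ j * (\<Sum>l\<in>UNIV. g $ (6 - j) $ l * y $ l))"
    by (intro sum.cong refl arg_cong2[where f = "(*)"] sum_UNIV_reflect)
  also have "\<dots> = form x (g *v y)"
    unfolding form_eq_sum_UNIV matrix_vector_mult_def by simp
  finally show ?thesis .
qed

lemma form_preserving_invertible:
  assumes "\<And>x y. form (g *v x) (g *v y) = form x y"
  shows "invertible g"
proof -
  define B where "B = form_adjoint g"
  have left_inverse: "B *v (g *v x) = x" for x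
  proof -
    have "form (B *v (g *v x) - x) y = 0" for y
      using assms by (simp add: B_def form_diff_left form_adjoint)
    then show ?thesis using form_nondegenerate by fastforce
  qed
  then have "B ** g = mat 1"
    by (simp add: matrix_eq matrix_vector_mul_assoc[symmetric])
  moreover have "g ** B = mat 1"
  proof -
    have "inj ((*v) g)" by (metis left_inverse injI)
    then have "surj ((*v) g)" by (simp add: finite_UNIV_inj_surj)
    have "g *v (B *v y) = y" for y
    proof -
      obtain x where "y = g *v x" using \<open>surj ((*v) g)\<close> by (metis surjD)
      then show ?thesis by (simp add: left_inverse)
    qed
    then show ?thesis by (simp add: matrix_eq matrix_vector_mul_assoc[symmetric])
  qed
  ultimately show ?thesis unfolding invertible_def by blast
qed

lemma matrix_inv_right:
  fixes g :: "'a::semiring_1^'n^'m"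
  shows "invertible g \<Longrightarrow> g ** matrix_inv g = mat 1"
  unfolding invertible_def matrix_inv_def by (rule someI_ex[THEN conjunct1])

lemma matrix_inv_left:
  fixes g :: "'a::semiring_1^'n^'m"
  shows "invertible g \<Longrightarrow> matrix_inv g ** g = mat 1"
  unfolding invertible_def matrix_inv_def by (rule someI_ex[THEN conjunct2])

lemma invertible_matrix_vector_mult_eq_0_iff:
  fixes g :: "'a::comm_semiring_1^'n^'n"
  assumes "invertible g"
  shows "g *v x = 0 \<longleftrightarrow> x = 0"
  by (metis matrix_inv_left[OF assms] matrix_vector_mul_assoc matrix_vector_mul_lid
      matrix_vector_mult_0_right)

definition std_flag :: "nat \<Rightarrow> vec7 set" where
  "std_flag n = {v. \<forall>i\<in>{n<..7}. v $ idx i = 0}"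

lemma axis_in_std_flag: "i \<in> {1..7} \<Longrightarrow> axis (idx i) 1 \<in> std_flag i"
  by (auto simp: std_flag_def axis_def idx_eq_iff)

lemma std_flag_nth_eq_0: "v \<in> std_flag n \<Longrightarrow> n < i \<Longrightarrow> i \<le> 7 \<Longrightarrow> v $ idx i = 0"
  by (simp add: std_flag_def)

lemma form_std_flag_orthogonal:
  assumes "v \<in> std_flag m" "w \<in> std_flag n" "m + n \<le> 7"
  shows "form v w = 0"
  unfolding form_def
proof (intro sum.neutral ballI)
  fix i assume i: "i \<in> {1..7::nat}"
  have "v $ idx i = 0 \<or> w $ idx (8 - i) = 0"
  proof (cases "m < i")
    case True
    then show ?thesis using assms(1) i by (simp add: std_flag_nth_eq_0)
  next
    case False
    then show ?thesis using assms(2,3) i by (simp add: std_flag_nth_eq_0)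
  qed
  then show "v $ idx i * w $ idx (8 - i) = 0" by auto
qed

lemma form_std_flag_4:
  assumes "v \<in> std_flag 4"
  shows "form v v = v $ idx 4 * v $ idx 4"
proof -
  have "v $ idx i * v $ idx (8 - i) = 0" if i: "i \<in> {1..7} - {4}" for i
  proof (cases "4 < i")
    case True
    then show ?thesis using assms i by (simp add: std_flag_nth_eq_0)
  next
    case False
    then have "4 < 8 - i" "8 - i \<le> 7" using i by auto
    then show ?thesis using std_flag_nth_eq_0[OF assms] by simp
  qed
  then show ?thesis
    unfolding form_def by (simp add: sum.remove[of _ 4])
qed

lemma matrix_vector_mult_std_flag:
  assumes "\<And>i j. n < i \<Longrightarrow> i \<le> 7 \<Longrightarrow> 1 \<le> j \<Longrightarrow> j \<le> m \<Longrightarrow> M $ idx i $ idx j = 0"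
    and "v \<in> std_flag m"
  shows "M *v v \<in> std_flag n"
proof -
  have "M $ idx i $ idx j * v $ idx j = 0" if "n < i" "i \<le> 7" "j \<in> {1..7}" for i j
  proof (cases "j \<le> m")
    case True
    then show ?thesis using assms(1) that by simp
  next
    case False
    then show ?thesis using assms(2) that by (simp add: std_flag_nth_eq_0)
  qed
  then show ?thesis
    by (simp add: std_flag_def matrix_vector_mult_def sum_UNIV_idx)
qed

lemma Ppos_std_flag:
  assumes "\<forall>(i, j)\<in>Ppos. M $ idx i $ idx j = 0"
  shows "(*v) M ` std_flag 1 \<subseteq> std_flag 2" and "(*v) M ` std_flag 2 \<subseteq> std_flag 4"
proof -
  have column_1: "M $ idx i $ idx j = 0" if "2 < i" "i \<le> 7" "1 \<le> j" "j \<le> 1" for i j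
    using that assms by (auto simp: Ppos_def numeral_eq_Suc le_Suc_eq)
  have columns_1_2: "M $ idx i $ idx j = 0" if "4 < i" "i \<le> 7" "1 \<le> j" "j \<le> 2" for i j
    using that assms by (auto simp: Ppos_def numeral_eq_Suc le_Suc_eq)
  show "(*v) M ` std_flag 1 \<subseteq> std_flag 2"
    by (rule image_subsetI, rule matrix_vector_mult_std_flag[OF column_1])
  show "(*v) M ` std_flag 2 \<subseteq> std_flag 4"
    by (rule image_subsetI, rule matrix_vector_mult_std_flag[OF columns_1_2])
qed

definition krylov_witness :: "mat7 \<Rightarrow> vec7 \<Rightarrow> bool" where
  "krylov_witness A v \<longleftrightarrow> form v v = 0 \<and> form v (A *v v) = 0
      \<and> form (A *v v) (A *v v) = 0 \<and> form (A *v v) (A *v (A *v v)) = 0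
      \<and> is_square (form (A *v (A *v v)) (A *v (A *v v)))"

lemma krylov_witness_std_flag:
  assumes "(*v) M ` std_flag 1 \<subseteq> std_flag 2" "(*v) M ` std_flag 2 \<subseteq> std_flag 4"
    and "u \<in> std_flag 1"
  shows "krylov_witness M u"
proof -
  have Mu: "M *v u \<in> std_flag 2" and MMu: "M *v (M *v u) \<in> std_flag 4"
    using assms by blast+
  show ?thesis
    unfolding krylov_witness_def is_square_def
    using form_std_flag_orthogonal[OF \<open>u \<in> std_flag 1\<close> \<open>u \<in> std_flag 1\<close>]
      form_std_flag_orthogonal[OF \<open>u \<in> std_flag 1\<close> Mu]
      form_std_flag_orthogonal[OF Mu Mu] form_std_flag_orthogonal[OF Mu MMu]
      form_std_flag_4[OF MMu]
    by auto
qed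

lemma krylov_witness_conjugate:
  assumes "\<And>x y. form (g *v x) (g *v y) = form x y" and "g ** M = A ** g"
    and "krylov_witness M u"
  shows "krylov_witness A (g *v u)"
proof -
  have "A *v (g *v w) = g *v (M *v w)" for w
    by (simp add: matrix_vector_mul_assoc assms(2))
  then show ?thesis using assms(3) by (simp add: krylov_witness_def assms(1))
qed

theorem mainTheorem10:
  fixes A :: mat7
  assumes "self_adjoint7 A"
    and "\<not> (\<exists>v :: vec7. v \<noteq> 0 \<and> form v v = 0 \<and> form v (A *v v) = 0
            \<and> form (A *v v) (A *v v) = 0 \<and> form (A *v v) (A *v (A *v v)) = 0
            \<and> is_square (form (A *v (A *v v)) (A *v (A *v v))))"
  shows "XA A = {}"
proof (rule ccontr)
  assume "XA A \<noteq> {}"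
  then obtain g where "g \<in> SO7"
    and pattern: "\<forall>(i, j)\<in>Ppos. (matrix_inv g ** A ** g) $ idx i $ idx j = 0"
    unfolding XA_def Let_def by blast
  define M where "M = matrix_inv g ** A ** g"
  have preserves: "\<And>x y. form (g *v x) (g *v y) = form x y"
    using \<open>g \<in> SO7\<close> by (simp add: SO7_def)
  then have "invertible g" by (rule form_preserving_invertible)
  then have "g ** M = A ** g"
    unfolding M_def by (metis matrix_inv_right matrix_mul_assoc matrix_mul_lid)
  define u :: vec7 where "u = axis (idx 1) 1"
  have "u \<in> std_flag 1" unfolding u_def by (rule axis_in_std_flag) simp
  then have "krylov_witness A (g *v u)"
    using Ppos_std_flag[OF pattern[folded M_def]]
    by (intro krylov_witness_conjugate[OF preserves \<open>g ** M = A ** g\<close>] krylov_witness_std_flag)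
  moreover have "g *v u \<noteq> 0"
    using invertible_matrix_vector_mult_eq_0_iff[OF \<open>invertible g\<close>]
    by (simp add: u_def axis_eq_0_iff)
  ultimately show False using assms(2) unfolding krylov_witness_def by blast
qed

end
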